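(* Let $n\ge 2$ and let $Q_{4n}=\langle x,y : y^{2n}=1,\ x^2=y^n,\ xyx^{-1}=y^{-1}\rangle$ be the generalized quaternion group of order $4n$. Then $$\text{L-Spec}(\Gamma_{Q_{4n}}) = \{0^{n+1},\ (2n-2)^{2n-3},\ 2^n\}$$ and $$\text{Q-Spec}(\Gamma_{Q_{4n}}) = \{(4n-6)^1,\ (2n-4)^{2n-3},\ 2^n,\ 0^n\}.$$
   Context: The commuting graph $\Gamma_G$ of a finite non-abelian group $G$ with center $Z(G)$ is the simple undirected graph with vertex set $G\setminus Z(G)$ in which two distinct vertices $x,y$ are adjacent if and only if $xy=yx$. For a finite graph $\mathcal{G}$ with adjacency matrix $A$ and (diagonal) degree matrix $D$, $\text{L-Spec}(\mathcal{G})$ and $\text{Q-Spec}(\mathcal{G})$ denote the multisets of eigenvalues (with multiplicity) of the Laplacian matrix $D-A$ and of the signless Laplacian matrix $D+A$, respectively. The notation $\{\alpha_1^{a_1},\dots,\alpha_l^{a_l}\}$ means the multiset in which $\alpha_i$ is listed $a_i$ times (if listed values coincide, their multiplicities add; an exponent $0$ means the value does not appear). *)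

theory Defs
  imports
    "HOL-Algebra.Group"
    "Graph_Theory.Pair_Digraph"
    "Jordan_Normal_Form.Char_Poly"
begin

section \<open>Groups given by generators and relations\<close>

text \<open>A word is a list of letters; the letter \<open>(g, True)\<close> stands for the generator \<open>g\<close> and
  \<open>(g, False)\<close> for its formal inverse. A relation \<open>u = v\<close> is the pair \<open>(u, v)\<close>.\<close>

type_synonym 'g word = "('g \<times> bool) list"

inductive pres_eq :: "('g word \<times> 'g word) set \<Rightarrow> 'g word \<Rightarrow> 'g word \<Rightarrow> bool" for R where
  cancel: "pres_eq R (p @ [(g, b), (g, \<not> b)] @ q) (p @ q)"
| rel: "(u, v) \<in> R \<Longrightarrow> pres_eq R (p @ u @ q) (p @ v @ q)"
| refl: "pres_eq R u u"
| sym: "pres_eq R u v \<Longrightarrow> pres_eq R v u"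
| trans: "pres_eq R u v \<Longrightarrow> pres_eq R v w \<Longrightarrow> pres_eq R u w"

definition pres_class :: "('g word \<times> 'g word) set \<Rightarrow> 'g word \<Rightarrow> 'g word set" where
  "pres_class R u = {v. pres_eq R u v}"

text \<open>All elements of the type \<open>'g\<close> are generators.\<close>

definition presented_group :: "('g word \<times> 'g word) set \<Rightarrow> 'g word set monoid" where
  "presented_group R =
     \<lparr> carrier = range (pres_class R),
       mult = (\<lambda>A B. \<Union>u\<in>A. \<Union>v\<in>B. pres_class R (u @ v)),
       one = pres_class R [] \<rparr>"

lemma pres_eq_context: "pres_eq R u v \<Longrightarrow> pres_eq R (p @ u @ q) (p @ v @ q)"
proof (induction rule: pres_eq.induct)
  case (cancel p' g b q')
  show ?case using pres_eq.cancel[of R "p @ p'" g b "q' @ q"] by simp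
next
  case (rel u v p' q')
  then show ?case using pres_eq.rel[of u v R "p @ p'" "q' @ q"] by simp
qed (rule pres_eq.refl, erule pres_eq.sym, erule (1) pres_eq.trans)

lemma pres_eq_append: "pres_eq R u u' \<Longrightarrow> pres_eq R v v' \<Longrightarrow> pres_eq R (u @ v) (u' @ v')"
  using pres_eq_context[of R u u' "[]" v] pres_eq_context[of R v v' u' "[]"]
  by (simp add: pres_eq.trans[of R "u @ v" "u' @ v"])

lemma pres_class_eq_iff: "pres_class R u = pres_class R v \<longleftrightarrow> pres_eq R u v"
proof
  assume "pres_class R u = pres_class R v"
  moreover have "v \<in> pres_class R v"
    by (simp add: pres_class_def pres_eq.refl)
  ultimately have "v \<in> pres_class R u"
    by simp
  then show "pres_eq R u v"
    by (simp add: pres_class_def)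
next
  assume uv: "pres_eq R u v"
  have "pres_eq R u w \<longleftrightarrow> pres_eq R v w" for w
    using pres_eq.trans[OF uv] pres_eq.trans[OF pres_eq.sym[OF uv]] by metis
  then show "pres_class R u = pres_class R v"
    by (simp add: pres_class_def)
qed

lemma presented_group_simps:
  "carrier (presented_group R) = range (pres_class R)"
  "one (presented_group R) = pres_class R []"
  by (simp_all add: presented_group_def)

lemma presented_group_mult:
  "pres_class R u \<otimes>\<^bsub>presented_group R\<^esub> pres_class R v = pres_class R (u @ v)"
proof -
  have *: "pres_class R (u' @ v') = pres_class R (u @ v)"
    if "u' \<in> pres_class R u" "v' \<in> pres_class R v" for u' v'
    unfolding pres_class_eq_iff
    using that by (intro pres_eq.sym[OF pres_eq_append]) (simp_all add: pres_class_def)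
  have "u \<in> pres_class R u" "v \<in> pres_class R v"
    by (simp_all add: pres_class_def pres_eq.refl)
  then have "(\<Union>u'\<in>pres_class R u. \<Union>v'\<in>pres_class R v. pres_class R (u @ v)) =
      pres_class R (u @ v)"
    by blast
  moreover have "(\<Union>u'\<in>pres_class R u. \<Union>v'\<in>pres_class R v. pres_class R (u' @ v')) =
      (\<Union>u'\<in>pres_class R u. \<Union>v'\<in>pres_class R v. pres_class R (u @ v))"
    by (rule SUP_cong[OF HOL.refl], rule SUP_cong[OF HOL.refl], rule *)
  ultimately show ?thesis
    by (simp only: presented_group_def monoid.simps)
qed

lemma pres_eq_inverse: "pres_eq R (rev (map (\<lambda>(g, b). (g, \<not> b)) u) @ u) []"
proof (induction u)
  case Nil
  show ?case by (simp add: pres_eq.refl)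
next
  case (Cons a u)
  obtain g b where a: "a = (g, b)" by (cases a)
  let ?v = "rev (map (\<lambda>(g, b). (g, \<not> b)) u)"
  have "pres_eq R (?v @ [(g, \<not> b), (g, \<not> \<not> b)] @ u) (?v @ u)"
    by (rule pres_eq.cancel)
  from pres_eq.trans[OF this Cons] show ?case by (simp add: a)
qed

lemma group_presented_group: "group (presented_group R)"
proof (rule groupI)
  fix x assume "x \<in> carrier (presented_group R)"
  then obtain u where u: "x = pres_class R u" by (auto simp: presented_group_simps)
  let ?v = "rev (map (\<lambda>(g, b). (g, \<not> b)) u)"
  have "pres_class R ?v \<otimes>\<^bsub>presented_group R\<^esub> x = \<one>\<^bsub>presented_group R\<^esub>"
    using pres_eq_inverse[of R u]
    by (simp add: u presented_group_mult presented_group_simps pres_class_eq_iff)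
  then show "\<exists>y\<in>carrier (presented_group R).
      y \<otimes>\<^bsub>presented_group R\<^esub> x = \<one>\<^bsub>presented_group R\<^esub>"
    by (auto simp: presented_group_simps)
next
  fix x y z
  assume "x \<in> carrier (presented_group R)" "y \<in> carrier (presented_group R)"
    "z \<in> carrier (presented_group R)"
  then show "x \<otimes>\<^bsub>presented_group R\<^esub> y \<otimes>\<^bsub>presented_group R\<^esub> z =
      x \<otimes>\<^bsub>presented_group R\<^esub> (y \<otimes>\<^bsub>presented_group R\<^esub> z)"
    unfolding presented_group_simps by (elim rangeE) (simp add: presented_group_mult)
next
  fix x y
  assume "x \<in> carrier (presented_group R)" "y \<in> carrier (presented_group R)"
  then show "x \<otimes>\<^bsub>presented_group R\<^esub> y \<in> carrier (presented_group R)"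
    unfolding presented_group_simps by (elim rangeE) (simp add: presented_group_mult)
next
  show "\<one>\<^bsub>presented_group R\<^esub> \<in> carrier (presented_group R)"
    by (simp add: presented_group_simps)
next
  fix x assume "x \<in> carrier (presented_group R)"
  then show "\<one>\<^bsub>presented_group R\<^esub> \<otimes>\<^bsub>presented_group R\<^esub> x = x"
    unfolding presented_group_simps by (elim rangeE) (simp add: presented_group_mult)
qed

section \<open>The generalized quaternion group\<close>

datatype quat_gen = Gen_x | Gen_y

definition quaternion_rels :: "nat \<Rightarrow> (quat_gen word \<times> quat_gen word) set" where
  "quaternion_rels n =
     {(replicate (2 * n) (Gen_y, True), []),
      ([(Gen_x, True), (Gen_x, True)], replicate n (Gen_y, True)),
      ([(Gen_x, True), (Gen_y, True), (Gen_x, False)], [(Gen_y, False)])}"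

definition generalized_quaternion :: "nat \<Rightarrow> quat_gen word set monoid" where
  "generalized_quaternion n = presented_group (quaternion_rels n)"

section \<open>Commuting graphs\<close>

definition center :: "('a, 'b) monoid_scheme \<Rightarrow> 'a set" where
  "center G = {z \<in> carrier G. \<forall>g\<in>carrier G. z \<otimes>\<^bsub>G\<^esub> g = g \<otimes>\<^bsub>G\<^esub> z}"

text \<open>A simple undirected graph is a symmetric, loop-free digraph without parallel arcs: each
  edge is represented by its two orientations.\<close>

definition commuting_graph :: "('a, 'b) monoid_scheme \<Rightarrow> 'a pair_pre_digraph" where
  "commuting_graph G =
     \<lparr> pverts = carrier G - center G,
       parcs = {(x, y). x \<in> carrier G - center G \<and> y \<in> carrier G - center G \<and>
                        x \<noteq> y \<and> x \<otimes>\<^bsub>G\<^esub> y = y \<otimes>\<^bsub>G\<^esub> x} \<rparr>"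

lemma pair_graph_commuting_graph:
  assumes "finite (carrier G)"
  shows "pair_graph (commuting_graph G)"
proof
  show "finite (parcs (commuting_graph G))"
    by (rule finite_subset[of _ "carrier G \<times> carrier G"])
       (use assms in \<open>auto simp: commuting_graph_def\<close>)
  show "symmetric (with_proj (commuting_graph G))"
    by (auto simp: symmetric_def commuting_graph_def intro!: symI)
qed (use assms in \<open>auto simp: commuting_graph_def\<close>)

section \<open>Laplacian and signless Laplacian spectra\<close>

text \<open>Rows and columns are indexed by positions in a list enumerating the vertices.\<close>

definition adjacency_mat :: "'a pair_pre_digraph \<Rightarrow> 'a list \<Rightarrow> complex mat" where
  "adjacency_mat G vs = mat (length vs) (length vs)
     (\<lambda>(i, j). if (vs ! i, vs ! j) \<in> parcs G then 1 else 0)"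

definition degree_mat :: "'a pair_pre_digraph \<Rightarrow> 'a list \<Rightarrow> complex mat" where
  "degree_mat G vs = mat (length vs) (length vs)
     (\<lambda>(i, j). if i = j then of_nat (out_degree (with_proj G) (vs ! i)) else 0)"

definition laplacian_mat :: "'a pair_pre_digraph \<Rightarrow> 'a list \<Rightarrow> complex mat" where
  "laplacian_mat G vs = degree_mat G vs - adjacency_mat G vs"

definition signless_laplacian_mat :: "'a pair_pre_digraph \<Rightarrow> 'a list \<Rightarrow> complex mat" where
  "signless_laplacian_mat G vs = degree_mat G vs + adjacency_mat G vs"

text \<open>Eigenvalues counted with algebraic multiplicity.\<close>

definition eigenvalue_mset :: "complex mat \<Rightarrow> complex multiset" where
  "eigenvalue_mset M = proots (char_poly M)"

definition vertex_list :: "'a pair_pre_digraph \<Rightarrow> 'a list" where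
  "vertex_list G = (SOME vs. distinct vs \<and> set vs = pverts G)"

definition L_Spec :: "'a pair_pre_digraph \<Rightarrow> complex multiset" where
  "L_Spec G = eigenvalue_mset (laplacian_mat G (vertex_list G))"

definition Q_Spec :: "'a pair_pre_digraph \<Rightarrow> complex multiset" where
  "Q_Spec G = eigenvalue_mset (signless_laplacian_mat G (vertex_list G))"

text \<open>The spectra do not depend on the chosen enumeration of the vertices.\<close>

lemma char_poly_reindex:
  fixes f :: "'a \<Rightarrow> 'a \<Rightarrow> complex"
  assumes vs: "distinct vs" and ws: "distinct ws" and eq: "set vs = set ws"
  shows "char_poly (mat (length vs) (length vs) (\<lambda>(i, j). f (vs ! i) (vs ! j))) =
         char_poly (mat (length ws) (length ws) (\<lambda>(i, j). f (ws ! i) (ws ! j)))"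
proof (rule char_poly_similar)
  define n where "n = length vs"
  have len: "length ws = n"
    using assms by (metis distinct_card n_def)
  define P where "P = (\<lambda>(us :: 'a list) (us' :: 'a list). mat n n (\<lambda>(i, j). if us ! i = us' ! j then 1 else 0 :: complex))"
  let ?M = "\<lambda>us. mat n n (\<lambda>(i, j). f (us ! i) (us ! j))"
  have pick: "(\<Sum>k = 0..<n. if us ! k = x then g (us ! k) else 0) = (g x :: complex)"
    if "distinct us" "length us = n" "x \<in> set us" for us :: "'a list" and x g
  proof -
    have "(\<Sum>k = 0..<n. if us ! k = x then g (us ! k) else 0) =
          (\<Sum>y\<in>set us. if y = x then g y else 0)"
      by (rule sum.reindex_bij_betw[OF bij_betw_nth]) (use that in auto)
    also have "\<dots> = g x"
      using that by (simp add: sum.delta)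
    finally show ?thesis .
  qed
  have inv: "P us us' * P us' us = 1\<^sub>m n"
    if "distinct us" "distinct us'" "length us = n" "length us' = n" "set us = set us'" for us us'
  proof (rule eq_matI)
    fix i j assume ij: "i < dim_row (1\<^sub>m n :: complex mat)" "j < dim_col (1\<^sub>m n :: complex mat)"
    have "(P us us' * P us' us) $$ (i, j) =
        (\<Sum>k = 0..<n. if us' ! k = us ! i then (if us' ! k = us ! j then 1 else 0) else 0)"
      using ij unfolding P_def by (auto simp: scalar_prod_def intro!: sum.cong)
    also have "\<dots> = (if us ! i = us ! j then 1 else 0)"
      by (rule pick[of us' "us ! i" "\<lambda>y. if y = us ! j then 1 else 0"])
         (use that ij nth_mem[of i us] in simp_all)
    finally show "(P us us' * P us' us) $$ (i, j) = 1\<^sub>m n $$ (i, j)"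
      using ij that by (simp add: nth_eq_iff_index_eq)
  qed (auto simp: P_def)
  have conj: "?M vs * P vs ws = P vs ws * ?M ws"
  proof (rule eq_matI)
    fix i j assume "i < dim_row (P vs ws * ?M ws)" "j < dim_col (P vs ws * ?M ws)"
    then have ij: "i < n" "j < n" by (auto simp: P_def)
    have "(?M vs * P vs ws) $$ (i, j) =
        (\<Sum>k = 0..<n. if vs ! k = ws ! j then f (vs ! i) (vs ! k) else 0)"
      using ij unfolding P_def by (auto simp: scalar_prod_def intro!: sum.cong)
    also have "\<dots> = f (vs ! i) (ws ! j)"
      by (rule pick[of vs "ws ! j" "f (vs ! i)"]) (use assms ij len in \<open>simp_all add: n_def\<close>)
    also have "\<dots> = (\<Sum>k = 0..<n. if ws ! k = vs ! i then f (ws ! k) (ws ! j) else 0)"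
      by (rule pick[of ws "vs ! i" "\<lambda>x. f x (ws ! j)", symmetric])
         (use assms ij len in \<open>simp_all add: n_def flip: eq\<close>)
    also have "\<dots> = (P vs ws * ?M ws) $$ (i, j)"
      using ij unfolding P_def by (auto simp: scalar_prod_def intro!: sum.cong)
    finally show "(?M vs * P vs ws) $$ (i, j) = (P vs ws * ?M ws) $$ (i, j)" .
  qed (auto simp: P_def)
  have carr: "P us us' \<in> carrier_mat n n" "?M us \<in> carrier_mat n n" for us us'
    by (auto simp: P_def)
  have PP: "P vs ws * P ws vs = 1\<^sub>m n" "P ws vs * P vs ws = 1\<^sub>m n"
    by (rule inv; use assms len n_def in simp)+
  have "?M vs = ?M vs * (P vs ws * P ws vs)"
    using carr by (simp add: PP)
  also have "\<dots> = P vs ws * ?M ws * P ws vs"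
    unfolding conj[symmetric] by (rule assoc_mult_mat[symmetric]; rule carr)
  finally have "similar_mat_wit (?M vs) (?M ws) (P vs ws) (P ws vs)"
    by (rule similar_mat_witI[OF PP]) (rule carr)+
  then show "similar_mat (mat (length vs) (length vs) (\<lambda>(i, j). f (vs ! i) (vs ! j)))
      (mat (length ws) (length ws) (\<lambda>(i, j). f (ws ! i) (ws ! j)))"
    unfolding similar_mat_def len n_def[symmetric] by blast
qed

lemma
  assumes "distinct vs" and "set vs = pverts G"
  shows L_Spec_eq: "L_Spec G = eigenvalue_mset (laplacian_mat G vs)"
    and Q_Spec_eq: "Q_Spec G = eigenvalue_mset (signless_laplacian_mat G vs)"
proof -
  let ?deg = "\<lambda>x. of_nat (out_degree (with_proj G) x) :: complex"
  let ?adj = "\<lambda>x y. (if (x, y) \<in> parcs G then 1 else 0) :: complex"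
  have vl: "distinct (vertex_list G) \<and> set (vertex_list G) = pverts G"
    unfolding vertex_list_def by (rule someI[of _ vs]) (use assms in simp)
  have L: "laplacian_mat G us = mat (length us) (length us)
      (\<lambda>(i, j). (\<lambda>x y. (if x = y then ?deg x else 0) - ?adj x y) (us ! i) (us ! j))"
    if "distinct us" for us
    by (rule eq_matI)
       (use that in \<open>auto simp: laplacian_mat_def degree_mat_def adjacency_mat_def
          nth_eq_iff_index_eq\<close>)
  have Q: "signless_laplacian_mat G us = mat (length us) (length us)
      (\<lambda>(i, j). (\<lambda>x y. (if x = y then ?deg x else 0) + ?adj x y) (us ! i) (us ! j))"
    if "distinct us" for us
    by (rule eq_matI)
       (use that in \<open>auto simp: signless_laplacian_mat_def degree_mat_def adjacency_mat_def
          nth_eq_iff_index_eq\<close>)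
  have d: "distinct (vertex_list G)" and s: "set (vertex_list G) = set vs"
    using vl assms by auto
  show "L_Spec G = eigenvalue_mset (laplacian_mat G vs)"
    unfolding L_Spec_def eigenvalue_mset_def L[OF d] L[OF assms(1)]
    by (rule arg_cong[OF char_poly_reindex[OF d assms(1) s]])
  show "Q_Spec G = eigenvalue_mset (signless_laplacian_mat G vs)"
    unfolding Q_Spec_def eigenvalue_mset_def Q[OF d] Q[OF assms(1)]
    by (rule arg_cong[OF char_poly_reindex[OF d assms(1) s]])
qed

end

theory Submission
  imports Defs
begin

text \<open>The elements of \<open>Q\<^sub>4\<^sub>n\<close> have unique normal forms \<open>y\<^sup>k x\<^sup>b\<close> with \<open>k\<close> modulo \<open>2n\<close> and
  \<open>b \<in> {0, 1}\<close>; uniqueness holds because the presented group acts on the set of normal forms as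
  left multiplication should. Computing with them, the center is \<open>{1, y\<^sup>n}\<close>, and commuting is an
  equivalence relation on the non-central elements, with classes
  \<open>\<langle>y\<rangle> - {1, y\<^sup>n}\<close> and \<open>{y\<^sup>k x, y\<^sup>k\<^sup>+\<^sup>n x}\<close> for \<open>0 \<le> k < n\<close>. So the commuting graph is the disjoint union
  of one clique of size \<open>2n - 2\<close> and \<open>n\<close> cliques of size 2, its matrices are block diagonal, and each
  block has the form \<open>p I + q J\<close> with \<open>J\<close> the all-ones matrix.\<close>

section \<open>Characteristic polynomials of block matrices\<close>

text \<open>Subtracting the matrix from X times the identity keeps the block triangular shape, so
  the determinant rule for block triangular matrices applies.\<close>

lemma char_poly_four_block_upper_right_zero:
  fixes A :: "'a :: idom mat"
  assumes A: "A \<in> carrier_mat n n" and B: "B \<in> carrier_mat m n" and C: "C \<in> carrier_mat m m"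
  shows "char_poly (four_block_mat A (0\<^sub>m n m) B C) = char_poly A * char_poly C"
proof -
  let ?cm = "\<lambda>A. [:0, 1:] \<cdot>\<^sub>m 1\<^sub>m (dim_row A) + map_mat (\<lambda>a. [:- a:]) A"
  have "char_poly (four_block_mat A (0\<^sub>m n m) B C) = det (?cm (four_block_mat A (0\<^sub>m n m) B C))"
    unfolding char_poly_defs using A C by simp
  also have "?cm (four_block_mat A (0\<^sub>m n m) B C) =
      four_block_mat (?cm A) (0\<^sub>m n m) (map_mat (\<lambda>a. [:- a:]) B) (?cm C)"
    by (rule eq_matI) (use assms in \<open>auto simp: one_poly_def\<close>)
  also have "det \<dots> = det (?cm A) * det (?cm C)"
    by (rule det_four_block_mat_upper_right_zero) (use assms in auto)
  finally show ?thesis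
    unfolding char_poly_defs .
qed

text \<open>Entries depend on vertices rather than positions, so a sublist of the vertices yields a
  diagonal block given by the same \<open>f\<close>.\<close>

definition mat_over :: "('a \<Rightarrow> 'a \<Rightarrow> 'b) \<Rightarrow> 'a list \<Rightarrow> 'b mat" where
  "mat_over f vs = mat (length vs) (length vs) (\<lambda>(i, j). f (vs ! i) (vs ! j))"

lemma char_poly_mat_over_append:
  fixes f :: "'a \<Rightarrow> 'a \<Rightarrow> 'b :: idom"
  assumes "\<And>a b. a \<in> set us \<Longrightarrow> b \<in> set vs \<Longrightarrow> f a b = 0"
  shows "char_poly (mat_over f (us @ vs)) = char_poly (mat_over f us) * char_poly (mat_over f vs)"
proof -
  have "mat_over f (us @ vs) =
      four_block_mat (mat_over f us) (0\<^sub>m (length us) (length vs))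
        (mat (length vs) (length us) (\<lambda>(i, j). f (vs ! i) (us ! j))) (mat_over f vs)"
    by (rule eq_matI) (auto simp: mat_over_def nth_append assms)
  then show ?thesis
    by (simp add: char_poly_four_block_upper_right_zero mat_over_def)
qed

text \<open>Induction splits off the first list. By distinctness its members occur in no later list,
  so the entries between it and the rest vanish.\<close>

lemma char_poly_mat_over_concat:
  fixes f :: "'a \<Rightarrow> 'a \<Rightarrow> 'b :: idom"
  assumes "distinct (concat Cs)"
    and "\<And>a b. a \<in> set (concat Cs) \<Longrightarrow> b \<in> set (concat Cs) \<Longrightarrow>
           \<not> (\<exists>C\<in>set Cs. a \<in> set C \<and> b \<in> set C) \<Longrightarrow> f a b = 0"
  shows "char_poly (mat_over f (concat Cs)) = (\<Prod>C\<leftarrow>Cs. char_poly (mat_over f C))"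
  using assms
proof (induction Cs)
  case Nil
  show ?case
    by (simp add: mat_over_def char_poly_defs det_def)
next
  case (Cons C Cs)
  have disj: "set C \<inter> (\<Union>D\<in>set Cs. set D) = {}"
    using Cons.prems(1) by simp
  have "char_poly (mat_over f (concat Cs)) = (\<Prod>C\<leftarrow>Cs. char_poly (mat_over f C))"
    using disj by (intro Cons.IH Cons.prems(2)) (use Cons.prems(1) in auto)
  moreover have "char_poly (mat_over f (C @ concat Cs)) =
      char_poly (mat_over f C) * char_poly (mat_over f (concat Cs))"
    using disj by (intro char_poly_mat_over_append Cons.prems(2)) auto
  ultimately show ?case
    by simp
qed

lemma char_poly_scalar_plus_ones:
  fixes p q :: "'a :: field"
  assumes "m > 0"
  shows "char_poly (mat m m (\<lambda>(i, j). if i = j then p + q else q)) =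
    [:- (p + of_nat m * q), 1:] * [:- p, 1:] ^ (m - 1)"
proof -
  txt \<open>Replacing the first basis vector by the all-ones vector makes the matrix triangular.\<close>
  define A where "A = mat m m (\<lambda>(i, j). if i = j then p + q else q)"
  define P where "P = mat m m (\<lambda>(i, j). if i = j \<or> j = 0 then 1 else 0 :: 'a)"
  define Q where "Q = mat m m (\<lambda>(i, j). if i = j then 1 else if j = 0 then - 1 else 0 :: 'a)"
  \<comment> \<open>The columns of \<open>T\<close> express that \<open>A\<close> sends the all-ones
    vector to \<open>p + m q\<close> times itself, and \<open>e_j\<close> to \<open>p e_j\<close>
    plus \<open>q\<close> times the all-ones vector.\<close>
  define T where "T = mat m m (\<lambda>(i, j). if i = j then if i = 0 then p + of_nat m * q else p
    else if i = 0 then q else 0)"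
  have carr: "A \<in> carrier_mat m m" "P \<in> carrier_mat m m" "Q \<in> carrier_mat m m" "T \<in> carrier_mat m m"
    by (simp_all add: A_def P_def Q_def T_def)
  \<comment> \<open>A row of \<open>P\<close> or \<open>Q\<close> is nonzero only in columns 0 and
    \<open>i\<close>; for \<open>i = 0\<close> the two coincide, hence the case split.\<close>
  have row_P: "(\<Sum>k = 0..<m. (if i = k \<or> k = 0 then 1 else 0) * g k) =
      (if i = 0 then g 0 else g 0 + g i)" if "i < m" for i and g :: "nat \<Rightarrow> 'a"
  proof -
    have "(\<Sum>k = 0..<m. (if i = k \<or> k = 0 then 1 else 0) * g k) =
        (\<Sum>k\<in>{0, i}. g k)"
      by (rule sum.mono_neutral_cong_right) (use that in auto)
    then show ?thesis
      by simp
  qed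
  have row_Q: "(\<Sum>k = 0..<m. (if i = k then 1 else if k = 0 then - 1 else 0) * g k) =
      (if i = 0 then g 0 else g i - g 0)" if "i < m" for i and g :: "nat \<Rightarrow> 'a"
  proof -
    have "(\<Sum>k = 0..<m. (if i = k then 1 else if k = 0 then - 1 else 0) * g k) =
        (\<Sum>k\<in>{0, i}. if i = k then g k else - g k)"
      by (rule sum.mono_neutral_cong_right) (use that in auto)
    then show ?thesis
      by auto
  qed
  have PQ: "P * Q = 1\<^sub>m m"
    by (rule eq_matI) (auto simp: P_def Q_def scalar_prod_def row_P)
  have QP: "Q * P = 1\<^sub>m m"
    by (rule eq_matI) (auto simp: P_def Q_def scalar_prod_def row_Q)
  have "A * P = P * T"
  proof (rule eq_matI)
    fix i j assume "i < dim_row (P * T)" "j < dim_col (P * T)"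
    then have ij: "i < m" "j < m"
      using carr by auto
    have "(A * P) $$ (i, j) = (\<Sum>k = 0..<m. (if i = k then p + q else q) * (if k = j \<or> j = 0 then 1 else 0))"
      using ij by (auto simp: A_def P_def scalar_prod_def intro!: sum.cong)
    \<comment> \<open>This is \<open>A = p I + q J\<close>: \<open>p\<close> times the entry of
      \<open>P\<close>, plus \<open>q\<close> times a column sum of \<open>P\<close>.\<close>
    also have "\<dots> = (\<Sum>k = 0..<m. (if k = i then (if i = j \<or> j = 0 then p else 0) else 0)) +
        (\<Sum>k = 0..<m. (if k = j \<or> j = 0 then q else 0))"
      unfolding sum.distrib[symmetric] by (rule sum.cong) auto
    also have "\<dots> = (if j = 0 then p + of_nat m * q else if i = j then p + q else q)"
      using ij by (cases "j = 0") simp_all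
    also have "\<dots> = (\<Sum>k = 0..<m. (if i = k \<or> k = 0 then 1 else 0) * T $$ (k, j))"
      using ij by (auto simp: row_P T_def)
    also have "\<dots> = (P * T) $$ (i, j)"
      using ij carr by (auto simp: P_def scalar_prod_def intro!: sum.cong)
    finally show "(A * P) $$ (i, j) = (P * T) $$ (i, j)" .
  qed (use carr in auto)
  then have "A * (P * Q) = P * T * Q"
    using carr by (metis assoc_mult_mat)
  then have "similar_mat_wit A T P Q"
    using carr PQ QP by (intro similar_mat_witI[of _ _ m]) auto
  then have "char_poly A = char_poly T"
    by (intro char_poly_similar) (auto simp: similar_mat_def)
  also have "\<dots> = (\<Prod>a\<leftarrow>diag_mat T. [:- a, 1:])"
    by (rule char_poly_upper_triangular[OF carr(4)]) (auto simp: upper_triangular_def T_def)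
  also have "diag_mat T = map (\<lambda>i. if i = 0 then p + of_nat m * q else p) [0..<m]"
    using carr by (auto simp: diag_mat_def T_def)
  also have "\<dots> = (p + of_nat m * q) # map (\<lambda>i. p) [1..<m]"
    using assms by (auto simp: upt_conv_Cons)
  finally show ?thesis
    unfolding A_def by (simp add: map_replicate_const)
qed

lemma char_poly_mat_over_const:
  fixes p q :: "'b :: field"
  assumes "distinct vs" and "vs \<noteq> []"
    and "\<And>a b. a \<in> set vs \<Longrightarrow> b \<in> set vs \<Longrightarrow> f a b = (if a = b then p + q else q)"
  shows "char_poly (mat_over f vs) =
    [:- (p + of_nat (length vs) * q), 1:] * [:- p, 1:] ^ (length vs - 1)"
proof -
  have "mat_over f vs =
      mat (length vs) (length vs) (\<lambda>(i, j). if i = j then p + q else q)"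
    by (rule eq_matI) (use assms in \<open>auto simp: mat_over_def nth_eq_iff_index_eq\<close>)
  then show ?thesis
    using assms(2) by (simp add: char_poly_scalar_plus_ones)
qed

section \<open>Spectra of disjoint unions of cliques\<close>

lemma proots_linear_factor_mult_power:
  fixes c d :: "'a :: field"
  shows "proots ([:- c, 1:] * [:- d, 1:] ^ k) = add_mset c (replicate_mset k d)"
proof -
  have "proots ([:- c, 1:] * [:- d, 1:] ^ k) = proots [:- c, 1:] + proots ([:- d, 1:] ^ k)"
    by (intro proots_mult) auto
  also have "\<dots> = add_mset c (replicate_mset k d)"
    by (simp add: proots_power multiset_eq_iff)
  finally show ?thesis .
qed

lemma proots_prod_list_map:
  fixes f :: "'a \<Rightarrow> 'b :: idom poly"
  assumes "\<And>x. x \<in> set xs \<Longrightarrow> f x \<noteq> 0"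
  shows "proots (\<Prod>x\<leftarrow>xs. f x) = (\<Sum>x\<leftarrow>xs. proots (f x))"
proof -
  have "0 \<notin> set (map f xs)"
    using assms by force
  then show ?thesis
    using proots_prod_list[of "map f xs"] by (simp add: o_def)
qed

text \<open>Cliques are lists, so that their concatenation enumerates the vertices block by block.
  They are nonempty because each contributes one eigenvalue besides the \<open>length C - 1\<close>
  equal ones.\<close>

locale clique_union =
  fixes G :: "'a pair_pre_digraph" and Cs :: "'a list list"
  assumes verts: "pverts G = set (concat Cs)"
    and distinct: "distinct (concat Cs)"
    and nonempty: "[] \<notin> set Cs"
    and arcs: "parcs G = {(a, b). a \<noteq> b \<and> (\<exists>C\<in>set Cs. a \<in> set C \<and> b \<in> set C)}"
begin

lemma clique_unique:
  "C \<in> set Cs \<Longrightarrow> D \<in> set Cs \<Longrightarrow> a \<in> set C \<Longrightarrow> a \<in> set D \<Longrightarrow> set C = set D"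
  using distinct by (auto simp: distinct_concat_iff)

text \<open>Serves to remove the truncated subtraction in \<open>length C - 1\<close>.\<close>

lemma length_clique: "C \<in> set Cs \<Longrightarrow> \<exists>k. length C = Suc k"
  using nonempty by (cases C) auto

lemma out_degree:
  assumes "C \<in> set Cs" and "a \<in> set C"
  shows "out_degree (with_proj G) a = length C - 1"
proof -
  have "(a, b) \<in> parcs G \<longleftrightarrow> b \<in> set C - {a}" for b
  proof
    assume "(a, b) \<in> parcs G"
    then obtain D where "D \<in> set Cs" "a \<in> set D" "b \<in> set D" "a \<noteq> b"
      by (auto simp: arcs)
    then show "b \<in> set C - {a}"
      using clique_unique[OF assms(1) _ assms(2)] by auto
  qed (use assms in \<open>auto simp: arcs\<close>)
  then have neighbours: "{b. (a, b) \<in> parcs G} = set C - {a}"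
    by blast
  have "e \<in> out_arcs (with_proj G) a \<longleftrightarrow> e \<in> Pair a ` {b. (a, b) \<in> parcs G}" for e
    by (cases e) auto
  then have "out_arcs (with_proj G) a = Pair a ` (set C - {a})"
    unfolding neighbours by (rule Set.set_eqI)
  then have "out_degree (with_proj G) a = card (set C - {a})"
    by (simp add: out_degree_def card_image inj_on_def)
  then show ?thesis
    using assms distinct by (simp add: distinct_card distinct_concat_iff)
qed

text \<open>The cases \<open>s = -1\<close> and \<open>s = 1\<close> are the Laplacian and the signless Laplacian.\<close>

lemma eigenvalues:
  fixes s :: complex
  defines "f \<equiv> \<lambda>a b. (if a = b then of_nat (out_degree (with_proj G) a) else 0) +
    (if (a, b) \<in> parcs G then s else 0)"
  shows "eigenvalue_mset (mat_over f (concat Cs)) =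
    (\<Sum>C\<leftarrow>Cs. add_mset ((1 + s) * of_nat (length C - 1))
      (replicate_mset (length C - 1) (of_nat (length C - 1) - s)))"
proof -
  have "char_poly (mat_over f C) =
      [:- ((1 + s) * of_nat (length C - 1)), 1:] *
      [:- (of_nat (length C - 1) - s), 1:] ^ (length C - 1)" if "C \<in> set Cs" for C
  proof -
    have "C \<noteq> []"
      using nonempty that by auto
    \<comment> \<open>A clique of m vertices gives the block \<open>(m - 1 - s) I + s J\<close>,
      whose constant row sum is \<open>(1 + s) (m - 1)\<close>.\<close>
    then have "(of_nat (length C - 1) - s) + of_nat (length C) * s =
        (1 + s) * of_nat (length C - 1)"
      by (cases C) (simp_all add: algebra_simps)
    moreover have "char_poly (mat_over f C) =
        [:- ((of_nat (length C - 1) - s) + of_nat (length C) * s), 1:] *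
        [:- (of_nat (length C - 1) - s), 1:] ^ (length C - 1)"
      by (rule char_poly_mat_over_const)
         (use that distinct \<open>C \<noteq> []\<close> out_degree[OF that] in
           \<open>auto simp: f_def arcs distinct_concat_iff\<close>)
    ultimately show ?thesis
      by simp
  qed
  then have "char_poly (mat_over f (concat Cs)) =
      (\<Prod>C\<leftarrow>Cs. [:- ((1 + s) * of_nat (length C - 1)), 1:] *
        [:- (of_nat (length C - 1) - s), 1:] ^ (length C - 1))"
    by (subst char_poly_mat_over_concat[OF distinct])
       (auto simp: f_def arcs intro!: arg_cong[where f = prod_list])
  then have "proots (char_poly (mat_over f (concat Cs))) =
      (\<Sum>C\<leftarrow>Cs. proots ([:- ((1 + s) * of_nat (length C - 1)), 1:] *
        [:- (of_nat (length C - 1) - s), 1:] ^ (length C - 1)))"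
    by (simp only:) (rule proots_prod_list_map, simp only: mult_eq_0_iff power_eq_0_iff, simp)
  then show ?thesis
    unfolding eigenvalue_mset_def proots_linear_factor_mult_power .
qed

lemma L_Spec: "L_Spec G = (\<Sum>C\<leftarrow>Cs. add_mset 0 (replicate_mset (length C - 1) (of_nat (length C))))"
proof -
  let ?f = "\<lambda>a b. (if a = b then of_nat (out_degree (with_proj G) a) else 0) +
    (if (a, b) \<in> parcs G then - 1 else 0) :: complex"
  have "laplacian_mat G (concat Cs) = mat_over ?f (concat Cs)"
    by (rule eq_matI)
       (use distinct in \<open>auto simp: laplacian_mat_def degree_mat_def adjacency_mat_def mat_over_def
          nth_eq_iff_index_eq\<close>)
  then have "L_Spec G = eigenvalue_mset (mat_over ?f (concat Cs))"
    by (simp add: L_Spec_eq[OF distinct verts[symmetric]])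
  also have "\<dots> = (\<Sum>C\<leftarrow>Cs. add_mset 0 (replicate_mset (length C - 1) (of_nat (length C))))"
    unfolding eigenvalues
    by (rule arg_cong[where f = sum_list, OF map_cong[OF HOL.refl]]) (drule length_clique, erule exE, simp add: add.commute)
  finally show ?thesis .
qed

lemma Q_Spec:
  "Q_Spec G = (\<Sum>C\<leftarrow>Cs. add_mset (2 * of_nat (length C - 1))
     (replicate_mset (length C - 1) (of_nat (length C) - 2)))"
proof -
  let ?f = "\<lambda>a b. (if a = b then of_nat (out_degree (with_proj G) a) else 0) +
    (if (a, b) \<in> parcs G then 1 else 0) :: complex"
  have "signless_laplacian_mat G (concat Cs) = mat_over ?f (concat Cs)"
    by (rule eq_matI)
       (use distinct in \<open>auto simp: signless_laplacian_mat_def degree_mat_def adjacency_mat_def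
          mat_over_def nth_eq_iff_index_eq\<close>)
  then have "Q_Spec G = eigenvalue_mset (mat_over ?f (concat Cs))"
    by (simp add: Q_Spec_eq[OF distinct verts[symmetric]])
  also have "\<dots> = (\<Sum>C\<leftarrow>Cs. add_mset (2 * of_nat (length C - 1))
     (replicate_mset (length C - 1) (of_nat (length C) - 2)))"
    unfolding eigenvalues
    by (rule arg_cong[where f = sum_list, OF map_cong[OF HOL.refl]]) (drule length_clique, erule exE, simp)
  finally show ?thesis .
qed

end

section \<open>Normal forms and the commuting graph\<close>

text \<open>Only the relations, in an arbitrary group: enough to multiply elements
  \<open>y^k x^b\<close>, without knowing that these are distinct or exhaust the group.\<close>

locale quaternion_relations = group G for G :: "('a, 'b) monoid_scheme" (structure) +
  fixes x y :: 'a and n :: nat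
  assumes x_carrier [simp]: "x \<in> carrier G" and y_carrier [simp]: "y \<in> carrier G"
    and y_pow: "y [^] (2 * n) = \<one>"
    and x_square: "x \<otimes> x = y [^] n"
    and conj: "x \<otimes> y \<otimes> inv x = inv y"
begin

text \<open>Integer exponents let inverses be written freely; reduction modulo \<open>2n\<close> is
  a separate step.\<close>

definition elt :: "int \<Rightarrow> bool \<Rightarrow> 'a" where
  "elt k b = y [^] k \<otimes> (if b then x else \<one>)"

lemma elt_carrier [simp]: "elt k b \<in> carrier G"
  by (simp add: elt_def)

text \<open>Conjugation by \<open>x\<close> is a homomorphism that inverts \<open>y\<close>, hence
  inverts every power of \<open>y\<close>.\<close>

lemma x_mult_y_pow: "x \<otimes> y [^] (k :: int) = y [^] (- k) \<otimes> x"
proof -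
  have "(\<lambda>z. x \<otimes> z \<otimes> inv x) \<in> hom G G"
    by (auto simp: hom_def m_assoc inv_solve_left)
  then have "x \<otimes> y [^] k \<otimes> inv x = inv y [^] k"
    using hom_int_pow[of "\<lambda>z. x \<otimes> z \<otimes> inv x" G G y k] by (simp add: conj is_group)
  then have "x \<otimes> y [^] k \<otimes> inv x = y [^] (- k)"
    by (simp add: int_pow_inv int_pow_neg)
  then show ?thesis
    by (metis inv_solve_right' int_pow_closed m_closed x_carrier y_carrier)
qed

lemma y_pow_mod: "y [^] (k mod (2 * int n)) = y [^] k"
proof -
  have "y [^] (2 * int n) = \<one>"
    using y_pow int_pow_int[of G y "2 * n"] by simp
  then have "y [^] (2 * int n * (k div (2 * int n))) = \<one>"
    by (metis int_pow_pow int_pow_one y_carrier)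
  then have "y [^] (2 * int n * (k div (2 * int n)) + k mod (2 * int n)) = y [^] (k mod (2 * int n))"
    by (subst int_pow_mult) auto
  then show ?thesis
    by simp
qed

lemma elt_mod: "elt (k mod (2 * int n)) b = elt k b"
  by (simp add: elt_def y_pow_mod)

text \<open>Moving \<open>x\<close> to the right past \<open>y^l\<close> negates the exponent, and
  two factors \<open>x\<close> merge into \<open>y^n\<close>.\<close>

lemma elt_mult:
  "elt k b \<otimes> elt l c =
    elt (k + (if b then - l else l) + (if b \<and> c then int n else 0)) (b \<noteq> c)"
proof -
  have xy: "x \<otimes> y [^] l = y [^] (- l) \<otimes> x"
    by (rule x_mult_y_pow)
  have "x \<otimes> (y [^] l \<otimes> x) = x \<otimes> y [^] l \<otimes> x"
    by (simp add: m_assoc)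
  also have "\<dots> = y [^] (- l) \<otimes> (x \<otimes> x)"
    by (simp add: xy m_assoc)
  also have "\<dots> = y [^] (- l) \<otimes> y [^] int n"
    by (simp add: x_square int_pow_int)
  finally have xyx: "x \<otimes> (y [^] l \<otimes> x) = y [^] (- l) \<otimes> y [^] int n" .
  show ?thesis
  proof (cases b; cases c)
    assume "b" "c"
    then show ?thesis
      by (simp add: elt_def m_assoc xyx int_pow_mult del: add_uminus_conv_diff)
  next
    assume "b" "\<not> c"
    then show ?thesis
      by (simp add: elt_def m_assoc xy int_pow_mult del: add_uminus_conv_diff)
  qed (simp_all add: elt_def m_assoc int_pow_mult)
qed

lemma one_eq_elt: "\<one> = elt 0 False"
  and x_eq_elt: "x = elt 0 True" and y_eq_elt: "y = elt 1 False"
  and inv_y_eq_elt: "inv y = elt (- 1) False"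
  by (simp_all add: elt_def int_pow_neg)

lemma inv_x_eq_elt: "inv x = elt (int n) True"
proof (rule inv_equality)
  have "elt (int n) True \<otimes> elt 0 True = elt (2 * int n mod (2 * int n)) False"
    by (subst elt_mod) (simp add: elt_mult)
  then show "elt (int n) True \<otimes> x = \<one>"
    by (simp flip: x_eq_elt one_eq_elt)
qed simp_all

end

text \<open>Adds that normal forms are unique and exhaust the group; for the presented group this
  comes from its action on normal forms and from induction on words.\<close>

locale quaternion_group = quaternion_relations +
  assumes n_ge_2: "n \<ge> 2"
    and elt_eqD: "elt k b = elt l c \<Longrightarrow> k mod (2 * int n) = l mod (2 * int n) \<and> b = c"
    and carrier_eq: "carrier G = range (\<lambda>(k, b). elt k b)"
begin

section \<open>Commutation, the center and the decomposition into cliques\<close>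

lemma elt_eq_iff: "elt k b = elt l c \<longleftrightarrow> k mod (2 * int n) = l mod (2 * int n) \<and> b = c"
proof
  assume "k mod (2 * int n) = l mod (2 * int n) \<and> b = c"
  then have "elt (k mod (2 * int n)) b = elt (l mod (2 * int n)) c"
    by simp
  then show "elt k b = elt l c"
    by (simp only: elt_mod)
qed (rule elt_eqD)

lemma carrierE:
  assumes "a \<in> carrier G"
  obtains k b where "0 \<le> k" "k < 2 * int n" "a = elt k b"
proof -
  from assms obtain k b where "a = elt k b"
    unfolding carrier_eq by auto
  then have "a = elt (k mod (2 * int n)) b"
    by (simp add: elt_mod)
  then show ?thesis
    using n_ge_2 by (intro that) auto
qed

text \<open>The exponents of the two products are equal or differ by some \<open>2d\<close>, and
  \<open>2n\<close> divides \<open>2d\<close> exactly if \<open>n\<close> divides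
  \<open>d\<close>.\<close>

lemma commute_iff:
  "elt k b \<otimes> elt l c = elt l c \<otimes> elt k b \<longleftrightarrow>
    (if b then if c then int n dvd k - l else int n dvd l else c \<longrightarrow> int n dvd k)"
proof -
  have mod_eq: "i mod (2 * int n) = j mod (2 * int n) \<longleftrightarrow> int n dvd d" if "i - j = 2 * d" for i j d
    using that by (simp add: mod_eq_dvd_iff)
  \<comment> \<open>The exponent differences when \<open>x\<close> occurs in both factors, in the
    first only, and in the second only.\<close>
  have "k - l + int n - (l - k + int n) = 2 * (k - l)" "k - l - (l + k) = 2 * (- l)"
    "k + l - (l - k) = 2 * k"
    by simp_all
  note mod_eq[OF this(1)] mod_eq[OF this(2)] mod_eq[OF this(3)]
  then show ?thesis
    by (auto simp: elt_mult elt_eq_iff algebra_simps)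
qed

lemma elt_in_center_iff: "elt k b \<in> center G \<longleftrightarrow> \<not> b \<and> int n dvd k"
proof
  assume "elt k b \<in> center G"
  \<comment> \<open>Commuting with \<open>y\<close> excludes \<open>b\<close>, as \<open>n\<close>
    does not divide 1; commuting with \<open>x\<close> then forces \<open>n\<close> to divide
    \<open>k\<close>.\<close>
  then have "elt k b \<otimes> elt 1 False = elt 1 False \<otimes> elt k b"
    "elt k b \<otimes> elt 0 True = elt 0 True \<otimes> elt k b"
    by (simp_all add: center_def)
  then show "\<not> b \<and> int n dvd k"
    using n_ge_2 by (auto simp: commute_iff split: if_splits)
next
  assume "\<not> b \<and> int n dvd k"
  then show "elt k b \<in> center G"
    by (auto simp: center_def commute_iff elim!: carrierE)
qed

text \<open>The two intervals leave out the exponents 0 and \<open>n\<close> of the central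
  elements. The cyclic class comes first and is thus \<open>hd cliques\<close>.\<close>

definition cliques :: "'a list list" where
  "cliques = map (\<lambda>k. elt k False) ([1..int n - 1] @ [int n + 1..2 * int n - 1]) #
     map (\<lambda>k. [elt k True, elt (k + int n) True]) [0..int n - 1]"

lemma set_concat_cliques: "set (concat cliques) =
  (\<lambda>k. elt k False) ` ({1..int n - 1} \<union> {int n + 1..2 * int n - 1}) \<union>
  (\<lambda>k. elt k True) ` {0..2 * int n - 1}"
proof -
  have "{0..2 * int n - 1} = {0..int n - 1} \<union> (\<lambda>k. k + int n) ` {0..int n - 1}"
    by auto
  then have "(\<lambda>k. elt k True) ` {0..2 * int n - 1} =
      (\<lambda>k. elt k True) ` {0..int n - 1} \<union> (\<lambda>k. elt (k + int n) True) ` {0..int n - 1}"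
    by (simp only: image_Un image_image)
  then show ?thesis
    unfolding cliques_def by (auto simp del: image_add_atLeastAtMost)
qed

lemma distinct_cliques: "distinct (concat cliques)"
proof -
  have "distinct (map (\<lambda>k. elt k False) ([1..int n - 1] @ [int n + 1..2 * int n - 1]))"
    by (auto simp: distinct_map inj_on_def elt_eq_iff)
  \<comment> \<open>Stated for any distinct list of exponents below \<open>n\<close>, so that
    induction applies.\<close>
  moreover have "distinct (concat (map (\<lambda>k. [elt k True, elt (k + int n) True]) ks))"
    if "distinct ks" "set ks \<subseteq> {0..<int n}" for ks
    using that by (induction ks) (auto simp: elt_eq_iff)
  then have "distinct (concat (map (\<lambda>k. [elt k True, elt (k + int n) True]) [0..int n - 1]))"
    by (simp add: subset_iff)
  ultimately show ?thesis
    by (auto simp: cliques_def elt_eq_iff)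
qed

lemma cliques_nonempty: "[] \<notin> set cliques"
  using n_ge_2 by (auto simp: cliques_def)

lemma pverts_commuting_graph: "pverts (commuting_graph G) = set (concat cliques)"
proof (intro Set.set_eqI iffI)
  fix a assume "a \<in> pverts (commuting_graph G)"
  then have "a \<in> carrier G" "a \<notin> center G"
    by (simp_all add: commuting_graph_def)
  then obtain k b where k: "0 \<le> k" "k < 2 * int n" "a = elt k b" "b \<or> \<not> int n dvd k"
    by (auto elim!: carrierE simp: elt_in_center_iff)
  show "a \<in> set (concat cliques)"
  proof (cases b)
    case True
    then show ?thesis
      using k unfolding set_concat_cliques by auto
  next
    case False
    then have "k \<noteq> 0" "k \<noteq> int n"
      using k by auto
    then show ?thesis
      using k False unfolding set_concat_cliques by auto
  qed
next
  fix a assume "a \<in> set (concat cliques)"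
  \<comment> \<open>Here \<open>k\<close> lies strictly between consecutive multiples of
    \<open>n\<close>; the upper interval is shifted down by \<open>n\<close>.\<close>
  moreover have "\<not> int n dvd k" if "k \<in> {1..int n - 1} \<union> {int n + 1..2 * int n - 1}" for k
    using that zdvd_not_zless[of k "int n"] zdvd_not_zless[of "k - int n" "int n"] by auto
  ultimately show "a \<in> pverts (commuting_graph G)"
    unfolding set_concat_cliques
    by (auto simp: commuting_graph_def elt_in_center_iff)
qed

text \<open>A residue class modulo \<open>n\<close> splits into two classes modulo
  \<open>2n\<close>, those of \<open>r\<close> and \<open>r + n\<close>; the parity of the quotient
  \<open>(k - r) / n\<close> selects one.\<close>

lemma elt_True_in_clique_iff:
  "elt k True \<in> {elt r True, elt (r + int n) True} \<longleftrightarrow> int n dvd k - r"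
proof -
  have "2 * int n dvd k - r \<or> 2 * int n dvd k - (r + int n)" if "int n dvd k - r"
  proof -
    from that obtain m where m: "k - r = int n * m" ..
    show ?thesis
    proof (cases "even m")
      case True
      then show ?thesis
        by (auto simp: m)
    next
      case False
      then obtain j where "m = 2 * j + 1" by (elim oddE)
      then have "k - (r + int n) = 2 * int n * j"
        using m by (simp add: algebra_simps)
      then show ?thesis
        by simp
    qed
  qed
  moreover have "int n dvd k - r" if "2 * int n dvd k - r \<or> 2 * int n dvd k - (r + int n)"
  proof -
    from that have "int n dvd k - r \<or> int n dvd k - r - int n"
      by (auto simp: diff_diff_eq dest: dvd_mult_right)
    then show ?thesis
      by (metis dvd_diff_commute dvd_minus_iff dvd_triv_left diff_add_cancel dvd_add_left_iff dvd_refl)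
  qed
  ultimately show ?thesis
    by (auto simp: elt_eq_iff mod_eq_dvd_iff)
qed

lemma parcs_commuting_graph:
  "parcs (commuting_graph G) =
    {(a, b). a \<noteq> b \<and> (\<exists>C\<in>set cliques. a \<in> set C \<and> b \<in> set C)}"
proof -
  let ?V = "set (concat cliques)"
  let ?S = "set (hd cliques)"
  have same_clique: "(\<exists>C\<in>set cliques. a \<in> set C \<and> b \<in> set C) \<longleftrightarrow>
      a \<in> ?S \<and> b \<in> ?S \<or>
      (\<exists>r\<in>{0..<int n}. a \<in> {elt r True, elt (r + int n) True} \<and>
        b \<in> {elt r True, elt (r + int n) True})" for a b
    unfolding cliques_def by auto
  have S_D: "\<exists>k. a = elt k False" if "a \<in> ?S" for a
    using that by (auto simp: cliques_def)
  have S_iff: "elt k b \<in> ?S \<longleftrightarrow> \<not> b" if "elt k b \<in> ?V" for k b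
  proof
    show "elt k b \<in> ?S \<Longrightarrow> \<not> b"
      by (auto dest!: S_D simp: elt_eq_iff)
    show "elt k b \<in> ?S" if "\<not> b"
      using \<open>elt k b \<in> ?V\<close> that by (auto simp: cliques_def elt_eq_iff)
  qed
  have commute: "elt k b \<otimes> elt l c = elt l c \<otimes> elt k b \<longleftrightarrow>
      (\<exists>C\<in>set cliques. elt k b \<in> set C \<and> elt l c \<in> set C)"
    if V: "elt k b \<in> ?V" "elt l c \<in> ?V" for k b l c
  proof (cases "b \<and> c")
    case True
    have "int n dvd k - l \<longleftrightarrow> (\<exists>r\<in>{0..<int n}. int n dvd k - r \<and> int n dvd l - r)"
    proof
      assume "int n dvd k - l"
      then have "k mod int n = l mod int n"
        by (simp add: mod_eq_dvd_iff)
      \<comment> \<open>The common residue of \<open>k\<close> and \<open>l\<close> modulo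
        \<open>n\<close> names their pair.\<close>
      then show "\<exists>r\<in>{0..<int n}. int n dvd k - r \<and> int n dvd l - r"
        using n_ge_2 by (intro bexI[of _ "k mod int n"]) (simp_all add: mod_eq_dvd_iff[symmetric])
    next
      assume "\<exists>r\<in>{0..<int n}. int n dvd k - r \<and> int n dvd l - r"
      then obtain r where "int n dvd (k - r) - (l - r)"
        using dvd_diff by blast
      then show "int n dvd k - l"
        by simp
    qed
    moreover have "elt k b \<notin> ?S"
      using S_iff[OF V(1)] True by simp
    ultimately show ?thesis
      using True unfolding same_clique commute_iff by (simp only: elt_True_in_clique_iff if_True simp_thms)
  next
    case False
    \<comment> \<open>A vertex that is a power of \<open>y\<close> is non-central, so it commutes
      with no \<open>y^l x\<close>, whereas powers of \<open>y\<close> always commute with each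
      other.\<close>
    have "\<not> int n dvd i" if "elt i False \<in> ?V" for i
      using that elt_in_center_iff[of i False] pverts_commuting_graph by (auto simp: commuting_graph_def)
    then have "elt k b \<otimes> elt l c = elt l c \<otimes> elt k b \<longleftrightarrow> \<not> b \<and> \<not> c"
      using V False by (cases b; cases c) (auto simp: commute_iff)
    moreover have "\<not> (\<exists>r\<in>{0..<int n}. elt k b \<in> {elt r True, elt (r + int n) True} \<and>
        elt l c \<in> {elt r True, elt (r + int n) True})"
      using False by (auto simp: elt_eq_iff)
    ultimately show ?thesis
      unfolding same_clique S_iff[OF V(1)] S_iff[OF V(2)] by blast
  qed
  have "(a, b) \<in> parcs (commuting_graph G) \<longleftrightarrow>
      a \<noteq> b \<and> (\<exists>C\<in>set cliques. a \<in> set C \<and> b \<in> set C)" for a b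
  proof (cases "a \<in> ?V \<and> b \<in> ?V")
    case True
    then have "a \<in> carrier G" "b \<in> carrier G"
      unfolding pverts_commuting_graph[symmetric] by (simp_all add: commuting_graph_def)
    then obtain k c l d where "a = elt k c" "b = elt l d"
      by (metis carrierE)
    moreover have "(a, b) \<in> parcs (commuting_graph G) \<longleftrightarrow> a \<noteq> b \<and> a \<otimes> b = b \<otimes> a"
      using True unfolding pverts_commuting_graph[symmetric] by (simp add: commuting_graph_def)
    ultimately show ?thesis
      using commute True by simp
  next
    case False
    then have "(a, b) \<notin> parcs (commuting_graph G)"
      unfolding pverts_commuting_graph[symmetric] by (auto simp: commuting_graph_def)
    moreover have "\<not> (\<exists>C\<in>set cliques. a \<in> set C \<and> b \<in> set C)"
      using False by auto
    ultimately show ?thesis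
      by simp
  qed
  then show ?thesis
    by (simp add: set_eq_iff)
qed

section \<open>The two spectra\<close>

sublocale cliques: clique_union "commuting_graph G" cliques
  by unfold_locales
    (fact pverts_commuting_graph distinct_cliques cliques_nonempty parcs_commuting_graph)+

text \<open>The contribution of a clique to either spectrum depends only on its size;
  \<open>f\<close> stands for that contribution.\<close>

lemma sum_list_cliques:
  fixes f :: "nat \<Rightarrow> 'c :: comm_monoid_add"
  shows "(\<Sum>C\<leftarrow>cliques. f (length C)) = f (2 * n - 2) + sum_list (replicate n (f 2))"
proof -
  have "nat (int n - 1) + nat (int n - 1) = 2 * n - 2"
    using n_ge_2 by linarith
  then show ?thesis
    by (simp add: cliques_def o_def map_replicate_const numeral_2_eq_2)
qed

text \<open>Each pair contributes the eigenvalues 0 and 2 to both spectra. The large clique supplies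
  the remaining 0 of the Laplacian and the simple eigenvalue \<open>2 (2n - 3)\<close> of the
  signless one.\<close>

lemma
  shows L_Spec: "L_Spec (commuting_graph G) =
      replicate_mset (n + 1) 0 + replicate_mset (2 * n - 3) (2 * of_nat n - 2) + replicate_mset n 2"
    and Q_Spec: "Q_Spec (commuting_graph G) =
      replicate_mset 1 (4 * of_nat n - 6) + replicate_mset (2 * n - 3) (2 * of_nat n - 4)
      + replicate_mset n 2 + replicate_mset n 0"
proof -
  have pairs: "sum_list (replicate k {#a, b#}) = replicate_mset k a + replicate_mset k b"
    for k and a b :: complex
    by (induction k) simp_all
  \<comment> \<open>This form makes the natural-number subtractions exact before they are cast to
    complex numbers.\<close>
  obtain m where "n = m + 2"
    using n_ge_2 by (metis add.commute le_Suc_ex)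
  then have nums: "2 * n - 2 - 1 = 2 * n - 3" "of_nat (2 * n - 2) = 2 * of_nat n - (2 :: complex)"
    "of_nat (2 * n - 3) = 2 * of_nat n - (3 :: complex)"
    by simp_all
  have two: "replicate_mset (2 - 1) c = {#c#}" for c :: complex
    by simp
  have "L_Spec (commuting_graph G) =
      add_mset 0 (replicate_mset (2 * n - 3) (2 * of_nat n - 2)) + sum_list (replicate n {#0, 2#})"
    unfolding cliques.L_Spec
      sum_list_cliques[of "\<lambda>k. add_mset 0 (replicate_mset (k - 1) (of_nat k))"] nums two
    by simp
  then show "L_Spec (commuting_graph G) =
      replicate_mset (n + 1) 0 + replicate_mset (2 * n - 3) (2 * of_nat n - 2) + replicate_mset n 2"
    by (simp add: pairs)
  have "Q_Spec (commuting_graph G) =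
      add_mset (2 * (2 * of_nat n - 3)) (replicate_mset (2 * n - 3) (2 * of_nat n - 2 - 2)) +
      sum_list (replicate n {#2, 0#})"
    unfolding cliques.Q_Spec
      sum_list_cliques[of "\<lambda>k. add_mset (2 * of_nat (k - 1)) (replicate_mset (k - 1) (of_nat k - 2))"]
      nums two
    by simp
  then show "Q_Spec (commuting_graph G) =
      replicate_mset 1 (4 * of_nat n - 6) + replicate_mset (2 * n - 3) (2 * of_nat n - 4)
      + replicate_mset n 2 + replicate_mset n 0"
    by (simp add: pairs algebra_simps)
qed

end

section \<open>The presented group acts on normal forms\<close>

text \<open>The action by left multiplication on the normal forms \<open>y\<^sup>k x\<^sup>b\<close>, encoded as pairs \<open>(k, b)\<close>.\<close>

fun letter_action :: "nat \<Rightarrow> quat_gen \<times> bool \<Rightarrow> int \<times> bool \<Rightarrow> int \<times> bool" where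
  "letter_action n (Gen_y, s) (k, b) = ((if s then k + 1 else k - 1) mod (2 * int n), b)"
| "letter_action n (Gen_x, s) (k, b) = ((if s = b then int n - k else - k) mod (2 * int n), \<not> b)"

definition word_action :: "nat \<Rightarrow> quat_gen word \<Rightarrow> int \<times> bool \<Rightarrow> int \<times> bool" where
  "word_action n = foldr (letter_action n)"

lemma word_action_simps [simp]:
  "word_action n [] = id"
  "word_action n (c # u) p = letter_action n c (word_action n u p)"
  "word_action n (u @ v) p = word_action n u (word_action n v p)"
  by (simp_all add: word_action_def)

text \<open>The equation \<open>fst p mod (2 * int n) = fst p\<close> singles out the reduced pairs;
  on these, inverse letters cancel exactly.\<close>

lemma fst_letter_action_mod: "fst (letter_action n c p) mod (2 * int n) = fst (letter_action n c p)"
  by (cases "(n, c, p)" rule: letter_action.cases) auto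

lemma fst_word_action_mod:
  "fst p mod (2 * int n) = fst p \<Longrightarrow> fst (word_action n u p) mod (2 * int n) = fst (word_action n u p)"
  by (cases u) (simp_all add: fst_letter_action_mod)

lemma letter_action_cancel:
  "fst p mod (2 * int n) = fst p \<Longrightarrow> letter_action n (g, b) (letter_action n (g, \<not> b) p) = p"
  by (cases p; cases g) (auto simp: mod_simps)

lemma word_action_replicate_y:
  "fst p mod (2 * int n) = fst p \<Longrightarrow> word_action n (replicate m (Gen_y, True)) p =
    ((fst p + int m) mod (2 * int n), snd p)"
  by (induction m) (auto simp: mod_simps algebra_simps)

lemma word_action_rels:
  assumes "(u, v) \<in> quaternion_rels n" and "fst p mod (2 * int n) = fst p"
  shows "word_action n u p = word_action n v p"
proof -
  \<comment> \<open>On a pair with \<open>b\<close> true, \<open>x x\<close> shifts the exponent by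
    \<open>-n\<close>, but \<open>y^n\<close> shifts it by \<open>n\<close>; these agree modulo
    \<open>2n\<close>.\<close>
  have "(k - int n) mod (int n * 2) = (k + int n) mod (int n * 2)" for k
    by (simp add: mod_eq_dvd_iff)
  then show ?thesis
    using assms
    by (cases p; cases "snd p")
      (auto simp: quaternion_rels_def word_action_replicate_y mod_simps algebra_simps)
qed

text \<open>This makes the action well defined on the presented group. Cancelled or replaced letters
  act on the image of a reduced pair under the right-hand context, which is again reduced.\<close>

lemma word_action_pres_eq:
  "pres_eq (quaternion_rels n) u v \<Longrightarrow> fst p mod (2 * int n) = fst p \<Longrightarrow>
    word_action n u p = word_action n v p"
  by (induction arbitrary: p rule: pres_eq.induct)
    (simp_all add: letter_action_cancel word_action_rels fst_word_action_mod)

lemma quaternion_group_generalized_quaternion: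
  assumes "n \<ge> 2"
  shows "quaternion_group (generalized_quaternion n)
    (pres_class (quaternion_rels n) [(Gen_x, True)]) (pres_class (quaternion_rels n) [(Gen_y, True)]) n"
proof -
  define R where "R = quaternion_rels n"
  define G where "G = generalized_quaternion n"
  define X where "X = pres_class R [(Gen_x, True)]"
  define Y where "Y = pres_class R [(Gen_y, True)]"
  note mult = presented_group_mult[of R, folded generalized_quaternion_def[of n, folded R_def G_def]]
  note simps = presented_group_simps[of R, folded generalized_quaternion_def[of n, folded R_def G_def]]
  interpret group G
    unfolding G_def generalized_quaternion_def by (rule group_presented_group)
  have classI [simp]: "pres_class R u \<in> carrier G" for u
    by (simp add: simps)
  have rel: "pres_class R u = pres_class R v" if "(u, v) \<in> R" for u v
    using pres_eq.rel[OF that, of "[]" "[]"] by (simp add: pres_class_eq_iff)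
  have inv_letter: "inv\<^bsub>G\<^esub> (pres_class R [(g, True)]) = pres_class R [(g, False)]" for g
    using pres_eq.cancel[of R "[]" g False "[]"]
    by (intro inv_equality) (simp_all add: mult simps(2) pres_class_eq_iff)
  have Y_pow: "Y [^]\<^bsub>G\<^esub> m = pres_class R (replicate m (Gen_y, True))" for m :: nat
    by (induction m) (simp_all add: Y_def mult simps(2) flip: replicate_append_same)
  interpret quaternion_relations G X Y n
  proof
    show "Y [^]\<^bsub>G\<^esub> (2 * n) = \<one>\<^bsub>G\<^esub>" "X \<otimes>\<^bsub>G\<^esub> X = Y [^]\<^bsub>G\<^esub> n"
      unfolding Y_pow simps(2) X_def mult
      by (rule rel, simp add: R_def quaternion_rels_def)+
    show "X \<otimes>\<^bsub>G\<^esub> Y \<otimes>\<^bsub>G\<^esub> inv\<^bsub>G\<^esub> X = inv\<^bsub>G\<^esub> Y"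
      unfolding X_def Y_def inv_letter mult
      by (rule rel, simp add: R_def quaternion_rels_def)
  qed (simp_all add: X_def Y_def)
  have "quaternion_group G X Y n"
  proof
    fix k l b c assume eq: "elt k b = elt l c"
    \<comment> \<open>A word for the normal form, its exponent reduced to a natural number so that
      it can be spelled out in letters.\<close>
    let ?w = "\<lambda>k b. replicate (nat (k mod (2 * int n))) (Gen_y, True) @ (if b then [(Gen_x, True)] else [])"
    have "elt k b = pres_class R (?w k b)" for k b
    proof -
      have "elt k b = Y [^]\<^bsub>G\<^esub> nat (k mod (2 * int n)) \<otimes>\<^bsub>G\<^esub> (if b then X else \<one>\<^bsub>G\<^esub>)"
        using assms elt_mod[of k b] by (simp add: elt_def flip: int_pow_int)
      then show ?thesis
        by (auto simp: Y_pow X_def mult simps(2))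
    qed
    then have "pres_eq R (?w k b) (?w l c)"
      using eq by (simp add: pres_class_eq_iff)
    \<comment> \<open>Acting on \<open>(0, False)\<close>, the normal form of the identity, recovers
      the reduced exponent and \<open>b\<close>.\<close>
    then have "word_action n (?w k b) (0, False) = word_action n (?w l c) (0, False)"
      unfolding R_def by (rule word_action_pres_eq) simp
    moreover have "word_action n (?w k b) (0, False) = (k mod (2 * int n), b)" for k b
      using assms by (simp add: word_action_replicate_y)
    ultimately show "k mod (2 * int n) = l mod (2 * int n) \<and> b = c"
      by simp
  next
    \<comment> \<open>Each letter is a normal form, and normal forms are closed under
      multiplication.\<close>
    have elt_class: "pres_class R u \<in> range (\<lambda>(k, b). elt k b)" for u
    proof (induction u)
      case Nil
      show ?case
        using one_eq_elt by (auto simp: simps(2))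
    next
      case (Cons c u)
      obtain g s where c: "c = (g, s)"
        by fastforce
      have "pres_class R [c] \<in> {X, Y, inv\<^bsub>G\<^esub> X, inv\<^bsub>G\<^esub> Y}"
        unfolding X_def Y_def inv_letter by (cases g; cases s) (simp_all add: c)
      then obtain k b where "pres_class R [c] = elt k b"
        using x_eq_elt y_eq_elt inv_x_eq_elt inv_y_eq_elt by blast
      moreover obtain l d where "pres_class R u = elt l d"
        using Cons by auto
      ultimately have "pres_class R (c # u) = elt k b \<otimes>\<^bsub>G\<^esub> elt l d"
        using mult[of "[c]" u] by simp
      then show ?case
        by (auto simp: elt_mult)
    qed
    then show "carrier G = range (\<lambda>(k, b). elt k b)"
      unfolding simps(1) using classI[unfolded simps(1)] elt_carrier[unfolded simps(1)] by auto
  qed (use assms in simp)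
  then show ?thesis
    by (simp add: G_def X_def Y_def R_def)
qed

theorem corollary2p8:
  fixes n :: nat
  assumes "n \<ge> 2"
  shows "L_Spec (commuting_graph (generalized_quaternion n)) =
           replicate_mset (n + 1) 0
           + replicate_mset (2 * n - 3) (2 * of_nat n - 2)
           + replicate_mset n 2
       \<and> Q_Spec (commuting_graph (generalized_quaternion n)) =
           replicate_mset 1 (4 * of_nat n - 6)
           + replicate_mset (2 * n - 3) (2 * of_nat n - 4)
           + replicate_mset n 2
           + replicate_mset n 0"
proof -
  interpret quaternion_group "generalized_quaternion n"
    "pres_class (quaternion_rels n) [(Gen_x, True)]" "pres_class (quaternion_rels n) [(Gen_y, True)]" n
    by (rule quaternion_group_generalized_quaternion[OF assms])
  show ?thesis
    using L_Spec Q_Spec by blast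
qed

end
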